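(* Let $\mathcal{D}=(\mathcal{P},\mathcal{B})$ be a non-trivial $G$-block-transitive $3$-$(v,k,1)$ design. Let $\alpha\in\mathcal{P}$ and $B\in\mathcal{B}$. Then: (a) $|G_\alpha|\,k(k-1)(k-2)=|G_B|\,(v-1)(v-2)$. (b) $|G_\alpha|\left(\frac{|G_\alpha|}{|G_B|}+2\right)^2>|G|$. (c) $\gcd\bigl(|G_\alpha|,(v-1)(v-2)\bigr)>\sqrt{v}-2$.
   Context: A $3$-$(v,k,1)$ design $\mathcal{D}=(\mathcal{P},\mathcal{B})$ consists of a finite set $\mathcal{P}$ of $v$ points and a collection $\mathcal{B}$ of $k$-subsets of $\mathcal{P}$, called blocks, such that each $3$-subset of $\mathcal{P}$ lies in a unique block. It is non-trivial if $3<k<v$. An automorphism of $\mathcal{D}$ is a permutation of $\mathcal{P}$ which permutes the blocks among themselves; these form the group $\mathrm{Aut}(\mathcal{D})$. For a subgroup $G\leq \mathrm{Aut}(\mathcal{D})$, the design is $G$-block-transitive if $G$ acts transitively on $\mathcal{B}$. $G_\alpha$ denotes the stabilizer in $G$ of the point $\alpha$, and $G_B$ the (setwise) stabilizer in $G$ of the block $B$. *)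

theory Defs
  imports Complex_Main "HOL-Algebra.Group_Action"
begin

definition three_design :: "'a set \<Rightarrow> 'a set set \<Rightarrow> nat \<Rightarrow> nat \<Rightarrow> bool"
  where "three_design P Bs v k \<longleftrightarrow>
    finite P \<and> card P = v \<and>
    (\<forall>B\<in>Bs. B \<subseteq> P \<and> card B = k) \<and>
    (\<forall>T. T \<subseteq> P \<and> card T = 3 \<longrightarrow> (\<exists>!B. B \<in> Bs \<and> T \<subseteq> B))"

definition nontrivial_three_design :: "'a set \<Rightarrow> 'a set set \<Rightarrow> nat \<Rightarrow> nat \<Rightarrow> bool"
  where "nontrivial_three_design P Bs v k \<longleftrightarrow> three_design P Bs v k \<and> 3 < k \<and> k < v"

definition aut_group :: "'a set \<Rightarrow> 'a set set \<Rightarrow> ('a \<Rightarrow> 'a) monoid"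
  where "aut_group P Bs =
    BijGroup P\<lparr>carrier := {g \<in> carrier (BijGroup P). bij_betw ((`) g) Bs Bs}\<rparr>"

text \<open>Restriction to \<open>Bs\<close> is needed because \<^const>\<open>Bij\<close> consists of extensional functions.\<close>

definition block_action :: "'a set set \<Rightarrow> ('a \<Rightarrow> 'a) \<Rightarrow> 'a set \<Rightarrow> 'a set"
  where "block_action Bs g = (\<lambda>B\<in>Bs. g ` B)"

definition block_transitive :: "'a set \<Rightarrow> 'a set set \<Rightarrow> ('a \<Rightarrow> 'a) set \<Rightarrow> bool"
  where "block_transitive P Bs G \<longleftrightarrow>
    subgroup G (aut_group P Bs) \<and>
    transitive_action (aut_group P Bs\<lparr>carrier := G\<rparr>) Bs (block_action Bs)"

definition point_stabilizer :: "'a set \<Rightarrow> 'a set set \<Rightarrow> ('a \<Rightarrow> 'a) set \<Rightarrow> 'a \<Rightarrow> ('a \<Rightarrow> 'a) set"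
  where "point_stabilizer P Bs G \<alpha> = stabilizer (aut_group P Bs\<lparr>carrier := G\<rparr>) (\<lambda>g. g) \<alpha>"

definition block_stabilizer :: "'a set \<Rightarrow> 'a set set \<Rightarrow> ('a \<Rightarrow> 'a) set \<Rightarrow> 'a set \<Rightarrow> ('a \<Rightarrow> 'a) set"
  where "block_stabilizer P Bs G B =
    stabilizer (aut_group P Bs\<lparr>carrier := G\<rparr>) (block_action Bs) B"

lemma aut_group_carrier:
  "g \<in> carrier (aut_group P Bs) \<longleftrightarrow> g \<in> Bij P \<and> bij_betw ((`) g) Bs Bs"
  by (simp add: aut_group_def BijGroup_def)

lemma aut_group_mult:
  assumes "g \<in> Bij P" "h \<in> Bij P"
  shows "g \<otimes>\<^bsub>aut_group P Bs\<^esub> h = compose P g h"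
  using assms by (simp add: aut_group_def BijGroup_def)

lemma image_compose_block: "B \<subseteq> P \<Longrightarrow> compose P g h ` B = g ` (h ` B)"
  by (auto simp: compose_def image_iff subset_iff; metis)

lemma subgroup_aut_group:
  assumes "\<forall>B\<in>Bs. B \<subseteq> P"
  shows "subgroup (carrier (aut_group P Bs)) (BijGroup P)"
proof -
  interpret group "BijGroup P" by (rule group_BijGroup)
  have one: "(\<lambda>x\<in>P. x) ` B = B" if "B \<in> Bs" for B
    using that assms by force
  have inv: "bij_betw ((`) (restrict (inv_into P g) P)) Bs Bs"
    if g: "g \<in> Bij P" "bij_betw ((`) g) Bs Bs" for g
  proof (rule bij_betw_byWitness[where f' = "(`) g"])
    have gP: "inj_on g P" "g ` P = P" using g(1) by (auto simp: Bij_def bij_betw_def)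
    have l: "restrict (inv_into P g) P ` (g ` B) = B" if "B \<in> Bs" for B
    proof -
      have "compose P (restrict (inv_into P g) P) g ` B = B"
        using g(1) one[OF that] by (simp add: Bij_compose_restrict_eq)
      then show ?thesis using that assms by (simp add: image_compose_block)
    qed
    have r: "\<exists>C\<in>Bs. B = g ` C" if "B \<in> Bs" for B
      using g(2) that by (metis bij_betw_def imageE)
    show "\<forall>B\<in>Bs. g ` (restrict (inv_into P g) P ` B) = B" by (metis l r)
    show "\<forall>B\<in>Bs. restrict (inv_into P g) P ` (g ` B) = B" using l by blast
    show "(`) (restrict (inv_into P g) P) ` Bs \<subseteq> Bs"
      using l r by (metis image_subsetI)
    show "(`) g ` Bs \<subseteq> Bs" using g(2) by (simp add: bij_betw_def)
  qed
  show ?thesis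
  proof (rule subgroupI)
    show "carrier (aut_group P Bs) \<subseteq> carrier (BijGroup P)"
      by (auto simp: aut_group_def)
    have "(\<lambda>x\<in>P. x) \<in> carrier (aut_group P Bs)"
      using bij_betw_cong[of Bs "(`) (\<lambda>x\<in>P. x)" id Bs] one
      by (auto simp: aut_group_carrier id_Bij)
    then show "carrier (aut_group P Bs) \<noteq> {}" by blast
  next
    fix g assume "g \<in> carrier (aut_group P Bs)"
    then show "inv\<^bsub>BijGroup P\<^esub> g \<in> carrier (aut_group P Bs)"
      using inv by (simp add: aut_group_carrier inv_BijGroup restrict_inv_into_Bij)
  next
    fix g h assume gh: "g \<in> carrier (aut_group P Bs)" "h \<in> carrier (aut_group P Bs)"
    have "bij_betw ((`) g \<circ> (`) h) Bs Bs"
      using gh bij_betw_trans by (auto simp: aut_group_carrier)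
    then have "bij_betw ((`) (compose P g h)) Bs Bs"
      using assms bij_betw_cong[of Bs "(`) (compose P g h)" "(`) g \<circ> (`) h" Bs]
      by (simp add: image_compose_block)
    then show "g \<otimes>\<^bsub>BijGroup P\<^esub> h \<in> carrier (aut_group P Bs)"
      using gh by (auto simp: aut_group_carrier BijGroup_def compose_Bij)
  qed
qed

lemma group_aut_group:
  assumes "\<forall>B\<in>Bs. B \<subseteq> P"
  shows "group (aut_group P Bs)"
proof -
  have "aut_group P Bs = BijGroup P\<lparr>carrier := carrier (aut_group P Bs)\<rparr>"
    by (simp add: aut_group_def)
  then show ?thesis
    using group.subgroup_imp_group[OF group_BijGroup subgroup_aut_group[OF assms]] by simp
qed

lemma group_action_blocks:
  assumes Bs: "\<forall>B\<in>Bs. B \<subseteq> P" and G: "subgroup G (aut_group P Bs)"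
  shows "group_action (aut_group P Bs\<lparr>carrier := G\<rparr>) Bs (block_action Bs)"
proof -
  have mem: "g \<in> Bij P" "bij_betw ((`) g) Bs Bs" if "g \<in> G" for g
    using that subgroup.subset[OF G] by (auto simp: aut_group_carrier)
  have act: "block_action Bs g \<in> Bij Bs" if "g \<in> G" for g
    using mem(2)[OF that] bij_betw_cong[of Bs "block_action Bs g" "(`) g" Bs]
    by (simp add: Bij_def block_action_def)
  have hom: "block_action Bs (compose P g h) =
      compose Bs (block_action Bs g) (block_action Bs h)" if "g \<in> G" "h \<in> G" for g h
  proof (rule ext)
    fix B
    show "block_action Bs (compose P g h) B =
        compose Bs (block_action Bs g) (block_action Bs h) B"
      using Bs bij_betwE[OF mem(2)[OF that(2)]]
      by (cases "B \<in> Bs") (simp_all add: block_action_def compose_def [of Bs] image_compose_block)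
  qed
  have "block_action Bs \<in> hom (aut_group P Bs\<lparr>carrier := G\<rparr>) (BijGroup Bs)"
    using act hom mem(1) by (auto simp: hom_def aut_group_mult BijGroup_def)
  then show ?thesis
    using group.subgroup_imp_group[OF group_aut_group[OF Bs] G] group_BijGroup
    by (simp add: group_action_def group_hom_def group_hom_axioms_def)
qed

lemma block_transitive_iff:
  assumes "\<forall>B\<in>Bs. B \<subseteq> P"
  shows "block_transitive P Bs G \<longleftrightarrow>
    subgroup G (aut_group P Bs) \<and> (\<forall>B\<in>Bs. \<forall>C\<in>Bs. \<exists>g\<in>G. g ` B = C)"
  using group_action_blocks[OF assms]
  by (auto simp: block_transitive_def transitive_action_def transitive_action_axioms_def
      block_action_def)

lemma point_stabilizer_eq: "point_stabilizer P Bs G \<alpha> = {g \<in> G. g \<alpha> = \<alpha>}"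
  by (simp add: point_stabilizer_def stabilizer_def)

lemma block_stabilizer_eq: "B \<in> Bs \<Longrightarrow> block_stabilizer P Bs G B = {g \<in> G. g ` B = B}"
  by (simp add: block_stabilizer_def stabilizer_def block_action_def)

end

theory Submission
  imports Defs
begin

text \<open>
  Everything follows from one equation and one inequality. The equation comes from computing the
  order of \<open>G\<close> twice by the orbit-stabilizer theorem, on the blocks and on the points. This
  requires \<open>G\<close> to be transitive on points as well. The reason is an instance of Block's lemma: a
  point orbit meets all blocks in equally many points, because \<open>G\<close> permutes the blocks
  transitively, and \<open>constant_block_intersection_imp_whole\<close> shows that only the whole
  point set can do so. Hence, with \<open>b\<close> the number of blocks,
  \<open>v |G\<^sub>\<alpha>| = |G| = b |G\<^sub>B|\<close>, and inserting
  \<open>b k (k - 1) (k - 2) = v (v - 1) (v - 2)\<close> gives (a).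

  By (a) the quotient \<open>x = |G\<^sub>\<alpha>| / |G\<^sub>B|\<close> equals
  \<open>(v - 1) (v - 2) / (k (k - 1) (k - 2))\<close>. The inequality is \<open>x > sqrt v - 2\<close>. It rests on
  Cameron's bound \<open>(k - 1) (k - 2) \<le> v - 2\<close> (\<open>nontrivial_three_design_bound\<close>), which forces
  \<open>k < sqrt v + 2\<close>.

  Part (b) is this inequality squared and multiplied by \<open>|G\<^sub>\<alpha>|\<close>, as
  \<open>|G| = v |G\<^sub>\<alpha>|\<close>. For (c), equation (a) says that
  \<open>(v - 1) (v - 2)\<close> divides \<open>|G\<^sub>\<alpha>| k (k - 1) (k - 2)\<close>, hence also
  \<open>gcd |G\<^sub>\<alpha>| ((v - 1) (v - 2)) * (k (k - 1) (k - 2))\<close>, so the gcd is at least \<open>x\<close>.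
\<close>

section \<open>Counting blocks\<close>

definition blocks_through :: "'a set set \<Rightarrow> 'a set \<Rightarrow> 'a set set"
  where "blocks_through Bs T = {C \<in> Bs. T \<subseteq> C}"

lemma three_designD:
  assumes "three_design P Bs v k"
  shows "finite P" "card P = v" "\<And>C. C \<in> Bs \<Longrightarrow> C \<subseteq> P" "\<And>C. C \<in> Bs \<Longrightarrow> card C = k"
    "\<And>C. C \<in> Bs \<Longrightarrow> finite C" "finite Bs"
proof -
  show *: "finite P" "card P = v" "\<And>C. C \<in> Bs \<Longrightarrow> C \<subseteq> P" "\<And>C. C \<in> Bs \<Longrightarrow> card C = k"
    using assms by (auto simp: three_design_def)
  show "\<And>C. C \<in> Bs \<Longrightarrow> finite C" using * finite_subset by blast
  show "finite Bs" using *(1,3) by (meson Pow_iff finite_Pow_iff finite_subset subsetI)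
qed

lemma unique_block:
  assumes "three_design P Bs v k" "T \<subseteq> P" "card T = 3"
  shows "\<exists>!C. C \<in> Bs \<and> T \<subseteq> C"
  using assms by (simp add: three_design_def)

text \<open>Double counting of the pairs of a block in \<open>X\<close> and a point of \<open>S\<close> on it.\<close>

lemma sum_card_Int_blocks:
  assumes "finite X" "finite S"
  shows "(\<Sum>C\<in>X. card (C \<inter> S)) = (\<Sum>x\<in>S. card {C \<in> X. x \<in> C})"
proof -
  have "(\<Sum>C\<in>X. card (C \<inter> S)) = (\<Sum>C\<in>X. card {x \<in> S. x \<in> C})"
    by (rule sum.cong) (auto intro: arg_cong[where f = card])
  also have "\<dots> = (\<Sum>x\<in>S. card {C \<in> X. x \<in> C})"
    using assms by (intro sum_multicount_gen) auto
  finally show ?thesis .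
qed

text \<open>
  Both sides count the ways to extend \<open>T\<close> by one further point inside a block through \<open>T\<close>.
  Applied with \<open>T\<close> of size 2, 1 and 0 in turn, this descends from the single block on
  three points to the total number of blocks.
\<close>

lemma card_blocks_through_insert:
  assumes D: "three_design P Bs v k" and T: "T \<subseteq> P"
  shows "card (blocks_through Bs T) * (k - card T)
       = (\<Sum>x\<in>P - T. card (blocks_through Bs (insert x T)))"
proof -
  note D' = three_designD[OF D]
  let ?X = "blocks_through Bs T"
  have fT: "finite T" using T D'(1) finite_subset by blast
  have "card (C \<inter> (P - T)) = k - card T" if "C \<in> ?X" for C
  proof -
    have "C \<in> Bs" "T \<subseteq> C" using that by (auto simp: blocks_through_def)
    moreover from this have "C \<inter> (P - T) = C - T" using D'(3) by blast
    ultimately show ?thesis using D'(4) fT by (simp add: card_Diff_subset)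
  qed
  then have "card ?X * (k - card T) = (\<Sum>C\<in>?X. card (C \<inter> (P - T)))" by simp
  also have "\<dots> = (\<Sum>x\<in>P - T. card {C \<in> ?X. x \<in> C})"
    using D' by (intro sum_card_Int_blocks) (auto simp: blocks_through_def)
  also have "\<dots> = (\<Sum>x\<in>P - T. card (blocks_through Bs (insert x T)))"
    by (rule sum.cong) (auto simp: blocks_through_def intro: arg_cong[where f = card])
  finally show ?thesis .
qed

lemma card_blocks_through_triple:
  assumes D: "three_design P Bs v k" and "T \<subseteq> P" "card T = 3"
  shows "card (blocks_through Bs T) = 1"
proof -
  have "\<exists>!C. C \<in> blocks_through Bs T"
    using unique_block[OF assms] by (simp add: blocks_through_def)
  then have "is_singleton (blocks_through Bs T)" by (metis empty_iff is_singletonI')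
  then show ?thesis by (simp add: is_singleton_altdef)
qed

lemma card_blocks_through_pair:
  assumes D: "three_design P Bs v k" and T: "T \<subseteq> P" "card T = 2"
  shows "card (blocks_through Bs T) * (k - 2) = v - 2"
proof -
  note D' = three_designD[OF D]
  have fT: "finite T" using T D'(1) finite_subset by blast
  have "card (blocks_through Bs (insert x T)) = 1" if "x \<in> P - T" for x
    using that T fT by (intro card_blocks_through_triple[OF D]) auto
  then show ?thesis
    using card_blocks_through_insert[OF D T(1)] T(2) fT
    by (simp add: card_Diff_subset[OF fT T(1)] D'(2))
qed

lemma card_blocks_through_point:
  assumes D: "three_design P Bs v k" and p: "p \<in> P"
  shows "card (blocks_through Bs {p}) * ((k - 1) * (k - 2)) = (v - 1) * (v - 2)"
proof -
  note D' = three_designD[OF D]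
  have "card (blocks_through Bs {p}) * (k - 1) * (k - 2)
      = (\<Sum>x\<in>P - {p}. card (blocks_through Bs {x, p}) * (k - 2))"
    using card_blocks_through_insert[OF D, of "{p}"] p by (simp add: sum_distrib_right)
  also have "\<dots> = (\<Sum>x\<in>P - {p}. v - 2)"
    using p by (intro sum.cong card_blocks_through_pair[OF D]) auto
  also have "\<dots> = (v - 1) * (v - 2)" using p D'(1,2) by simp
  finally show ?thesis by (simp add: mult.assoc)
qed

lemma card_blocks:
  assumes D: "three_design P Bs v k"
  shows "card Bs * (k * (k - 1) * (k - 2)) = v * ((v - 1) * (v - 2))"
proof -
  note D' = three_designD[OF D]
  have "blocks_through Bs {} = Bs" by (simp add: blocks_through_def)
  then have "card Bs * k * ((k - 1) * (k - 2))
      = (\<Sum>x\<in>P. card (blocks_through Bs {x}) * ((k - 1) * (k - 2)))"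
    using card_blocks_through_insert[OF D, of "{}"] by (simp add: sum_distrib_right)
  also have "\<dots> = (\<Sum>x\<in>P. (v - 1) * (v - 2))"
    by (intro sum.cong card_blocks_through_point[OF D]) auto
  also have "\<dots> = v * ((v - 1) * (v - 2))" using D'(2) by simp
  finally show ?thesis by (simp add: mult.assoc)
qed

section \<open>Cameron's bound\<close>

text \<open>
  Fix a block \<open>B\<close>, a point \<open>p\<close> on it and a point \<open>q\<close> off it. For each of the \<open>k - 1\<close> other points
  \<open>y\<close> of \<open>B\<close> there is a block through \<open>p\<close>, \<open>q\<close>, \<open>y\<close>. No two of these blocks share a third
  point: they would coincide, meet \<open>B\<close> in three points and so be \<open>B\<close>, which misses \<open>q\<close>.
  Away from \<open>p\<close> and \<open>q\<close> they thus occupy \<open>(k - 1) (k - 2)\<close> of the remaining \<open>v - 2\<close> points.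
\<close>

lemma nontrivial_three_design_bound:
  assumes N: "nontrivial_three_design P Bs v k" and B: "B \<in> Bs"
  shows "(k - 1) * (k - 2) \<le> v - 2"
proof -
  have D: "three_design P Bs v k" and k: "3 < k" "k < v"
    using N by (auto simp: nontrivial_three_design_def)
  note D' = three_designD[OF D]
  obtain p where p: "p \<in> B" using D'(4)[OF B] k by fastforce
  have "card B < card P" using D'(2) D'(4)[OF B] k by simp
  then obtain q where q: "q \<in> P" "q \<notin> B"
    using D'(5)[OF B] by (metis card_mono linorder_not_le subsetI)
  have "\<forall>y\<in>B - {p}. \<exists>C. C \<in> Bs \<and> {p, q, y} \<subseteq> C"
  proof
    fix y assume "y \<in> B - {p}"
    then show "\<exists>C. C \<in> Bs \<and> {p, q, y} \<subseteq> C"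
      using p q D'(3)[OF B] by (intro ex1_implies_ex unique_block[OF D]) (auto simp: card_insert_if)
  qed
  then obtain C where C: "\<And>y. y \<in> B - {p} \<Longrightarrow> C y \<in> Bs \<and> {p, q, y} \<subseteq> C y"
    by metis
  have same: "C1 = C2"
    if "C1 \<in> Bs" "C2 \<in> Bs" "{x, y, z} \<subseteq> C1 \<inter> C2" "x \<noteq> y" "x \<noteq> z" "y \<noteq> z" for C1 C2 x y z
  proof -
    have "\<exists>!C. C \<in> Bs \<and> {x, y, z} \<subseteq> C"
      using that D'(3)[OF that(1)] by (intro unique_block[OF D]) auto
    then show ?thesis using that(1-3) by (metis le_inf_iff)
  qed
  have disj: "(C y - {p, q}) \<inter> (C z - {p, q}) = {}"
    if yz: "y \<in> B - {p}" "z \<in> B - {p}" "y \<noteq> z" for y z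
  proof (rule ccontr)
    assume "(C y - {p, q}) \<inter> (C z - {p, q}) \<noteq> {}"
    then obtain w where w: "w \<in> C y" "w \<in> C z" "w \<noteq> p" "w \<noteq> q" by blast
    have "C y = C z"
      using C[OF yz(1)] C[OF yz(2)] w p q by (intro same[of _ _ p q w]) auto
    moreover from this have "C y = B"
      using C[OF yz(1)] C[OF yz(2)] yz p B by (intro same[of _ _ p y z]) auto
    ultimately show False using C[OF yz(1)] q by auto
  qed
  have "card (\<Union>y\<in>B - {p}. C y - {p, q}) = (\<Sum>y\<in>B - {p}. card (C y - {p, q}))"
    using D'(5) B C disj by (intro card_UN_disjoint) auto
  also have "\<dots> = (\<Sum>y\<in>B - {p}. k - 2)"
  proof (rule sum.cong)
    fix y assume "y \<in> B - {p}"
    then have "C y \<in> Bs" "{p, q} \<subseteq> C y" using C by auto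
    moreover have "p \<noteq> q" using p q by auto
    ultimately show "card (C y - {p, q}) = k - 2" using D'(4) by (simp add: card_Diff_subset)
  qed simp
  also have "\<dots> = (k - 1) * (k - 2)" using D'(4,5)[OF B] p by simp
  finally have "(k - 1) * (k - 2) = card (\<Union>y\<in>B - {p}. C y - {p, q})" by simp
  also have "\<dots> \<le> card (P - {p, q})"
  proof (rule card_mono)
    show "(\<Union>y\<in>B - {p}. C y - {p, q}) \<subseteq> P - {p, q}" using C D'(3) by blast
  qed (use D'(1) in simp)
  also have "\<dots> = v - 2"
    using p q D'(1,2) D'(3)[OF B] by (subst card_Diff_subset) (auto simp: card_insert_if)
  finally show ?thesis .
qed

text \<open>
  The two bounds on \<open>k\<close> are used for different factors: \<open>(k - 1) (k - 2) \<le> v - 2\<close> cancels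
  \<open>v - 2\<close>, and \<open>k < sqrt v + 2\<close> gives
  \<open>(sqrt v - 2) k < v - 4 < v - 1\<close> for the rest.
\<close>

lemma sqrt_less_quotient:
  fixes v k :: nat
  assumes k: "3 < k" "k < v" and bound: "(k - 1) * (k - 2) \<le> v - 2"
  shows "(sqrt v - 2) * (real k * (real k - 1) * (real k - 2)) < (real v - 1) * (real v - 2)"
proof -
  define s where "s = sqrt (real v)"
  have s2: "s * s = real v" by (simp add: s_def)
  have "2\<^sup>2 < real v" using k by simp
  then have s: "2 < s" unfolding s_def by (rule real_less_rsqrt)
  have "real ((k - 1) * (k - 2)) \<le> real (v - 2)" using bound by (rule of_nat_mono)
  then have b: "(real k - 1) * (real k - 2) \<le> real v - 2" using k by (simp add: of_nat_diff)
  \<comment> \<open>Otherwise \<open>(k - 1) (k - 2) \<ge> (s + 1) s\<close>, which exceeds \<open>s\<^sup>2 - 2 = v - 2\<close>.\<close>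
  have "real k < s + 2"
  proof (rule ccontr)
    assume "\<not> real k < s + 2"
    then have "(s + 1) * s \<le> (real k - 1) * (real k - 2)" using s by (intro mult_mono) auto
    then show False using b s s2 by (simp add: algebra_simps)
  qed
  then have "(s - 2) * real k \<le> (s - 2) * (s + 2)" using s by (intro mult_left_mono) auto
  also have "\<dots> < real v - 1" using s2 by (simp add: algebra_simps)
  finally have "(s - 2) * real k < real v - 1" .
  have "(s - 2) * real k * ((real k - 1) * (real k - 2)) \<le> (s - 2) * real k * (real v - 2)"
    using b s by (intro mult_left_mono) auto
  also have "\<dots> < (real v - 1) * (real v - 2)"
    using \<open>(s - 2) * real k < real v - 1\<close> k by (intro mult_strict_right_mono) auto
  finally show ?thesis by (simp add: s_def mult.assoc)
qed

section \<open>Transitivity on points\<close>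

text \<open>
  Suppose that \<open>p\<close> lies in \<open>S\<close> and \<open>q\<close> does not. Count the pairs of a block through \<open>p\<close> and a
  point of \<open>S\<close> on it, and likewise for \<open>q\<close>. Both counts equal \<open>m\<close> times the number \<open>r\<close> of blocks
  on a point. But \<open>p\<close> itself contributes \<open>r\<close> to the first count, whereas every other point
  contributes only the number of blocks on two points. So these two numbers would be equal, which
  is impossible for \<open>k < v\<close>.
\<close>

lemma constant_block_intersection_imp_whole:
  assumes N: "nontrivial_three_design P Bs v k"
    and S: "S \<subseteq> P" "S \<noteq> {}" and m: "\<And>C. C \<in> Bs \<Longrightarrow> card (C \<inter> S) = m"
  shows "S = P"
proof (rule ccontr)
  assume "S \<noteq> P"
  have D: "three_design P Bs v k" and k: "3 < k" "k < v"
    using N by (auto simp: nontrivial_three_design_def)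
  note D' = three_designD[OF D]
  obtain p q where p: "p \<in> S" and q: "q \<in> P" "q \<notin> S" using S \<open>S \<noteq> P\<close> by blast
  have fS: "finite S" using S D'(1) finite_subset by blast
  define r where "r x = card (blocks_through Bs {x})" for x
  have r: "r x * ((k - 1) * (k - 2)) = (v - 1) * (v - 2)" if "x \<in> P" for x
    using card_blocks_through_point[OF D that] by (simp add: r_def)
  have "r q * ((k - 1) * (k - 2)) = r p * ((k - 1) * (k - 2))"
    using r[of p] r[of q] p q S by auto
  then have rq: "r q = r p" using k by simp
  have flags: "m * r x = (\<Sum>y\<in>S. card (blocks_through Bs {x, y}))" for x
  proof -
    have "m * r x = (\<Sum>C\<in>blocks_through Bs {x}. card (C \<inter> S))"
      using m by (simp add: r_def blocks_through_def)
    also have "\<dots> = (\<Sum>y\<in>S. card {C \<in> blocks_through Bs {x}. y \<in> C})"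
      using D'(6) fS by (intro sum_card_Int_blocks) (auto simp: blocks_through_def)
    also have "\<dots> = (\<Sum>y\<in>S. card (blocks_through Bs {x, y}))"
      by (rule sum.cong) (auto simp: blocks_through_def intro: arg_cong[where f = card])
    finally show ?thesis .
  qed
  have pair: "card (blocks_through Bs {x, y}) * (k - 2) = v - 2"
    if "x \<in> P" "y \<in> P" "x \<noteq> y" for x y
    using that by (intro card_blocks_through_pair[OF D]) auto
  have "m * r q * (k - 2) = (\<Sum>y\<in>S. card (blocks_through Bs {q, y}) * (k - 2))"
    using flags by (simp add: sum_distrib_right)
  also have "\<dots> = (\<Sum>y\<in>S. v - 2)"
    using q S by (intro sum.cong pair) auto
  finally have out: "m * r q * (k - 2) = card S * (v - 2)" by simp
  have "m * r p * (k - 2) = (\<Sum>y\<in>S. card (blocks_through Bs {p, y}) * (k - 2))"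
    using flags by (simp add: sum_distrib_right)
  also have "\<dots> = r p * (k - 2) + (\<Sum>y\<in>S - {p}. card (blocks_through Bs {p, y}) * (k - 2))"
    using p fS by (simp add: sum.remove r_def)
  also have "(\<Sum>y\<in>S - {p}. card (blocks_through Bs {p, y}) * (k - 2)) = (\<Sum>y\<in>S - {p}. v - 2)"
    using p S by (intro sum.cong pair) auto
  finally have ins: "m * r p * (k - 2) = r p * (k - 2) + (card S - 1) * (v - 2)"
    using p fS by simp
  have "card S = Suc (card S - 1)" using p fS by (metis card_Suc_Diff1 card_Diff_singleton)
  then have "card S * (v - 2) = (v - 2) + (card S - 1) * (v - 2)" by (metis mult_Suc)
  then have "r p * (k - 2) = v - 2" using out ins rq by simp
  then have "(v - 2) * (k - 1) = (v - 2) * (v - 1)"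
    using r[of p] p S by (metis mult.assoc mult.commute subsetD)
  then show False using k by simp
qed

lemma group_action_points:
  assumes Bs: "\<forall>C\<in>Bs. C \<subseteq> P" and G: "subgroup G (aut_group P Bs)"
  shows "group_action (aut_group P Bs\<lparr>carrier := G\<rparr>) P (\<lambda>g. g)"
proof -
  have "(\<lambda>g. g) \<in> hom (aut_group P Bs\<lparr>carrier := G\<rparr>) (BijGroup P)"
    using subgroup.subset[OF G] by (auto simp: hom_def aut_group_def)
  then show ?thesis
    using group.subgroup_imp_group[OF group_aut_group[OF Bs] G] group_BijGroup
    by (simp add: group_action_def group_hom_def group_hom_axioms_def)
qed

lemma block_transitive_imp_point_transitive:
  assumes N: "nontrivial_three_design P Bs v k" and T: "block_transitive P Bs G"
    and a: "\<alpha> \<in> P"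
  shows "orbit (aut_group P Bs\<lparr>carrier := G\<rparr>) (\<lambda>g. g) \<alpha> = P"
proof -
  have D: "three_design P Bs v k" using N by (simp add: nontrivial_three_design_def)
  note D' = three_designD[OF D]
  have Bs: "\<forall>C\<in>Bs. C \<subseteq> P" using D'(3) by blast
  have G: "subgroup G (aut_group P Bs)" and tr: "\<forall>C\<in>Bs. \<forall>E\<in>Bs. \<exists>g\<in>G. g ` C = E"
    using T block_transitive_iff[OF Bs] by auto
  interpret A: group_action "aut_group P Bs\<lparr>carrier := G\<rparr>" P "\<lambda>g. g"
    by (rule group_action_points[OF Bs G])
  let ?O = "orbit (aut_group P Bs\<lparr>carrier := G\<rparr>) (\<lambda>g. g) \<alpha>"
  have bij: "bij_betw g P P" if "g \<in> G" for g
    using that subgroup.subset[OF G] by (auto simp: aut_group_carrier Bij_def)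
  have sub: "?O \<subseteq> P" using bij a by (auto simp: orbit_def bij_betw_def)
  have ne: "\<alpha> \<in> ?O" using A.orbit_refl[OF a] .
  \<comment> \<open>Invariance in both directions: \<open>g\<close> then maps \<open>C \<inter> ?O\<close> onto all of \<open>g ` C \<inter> ?O\<close>.\<close>
  have inv: "g x \<in> ?O \<longleftrightarrow> x \<in> ?O" if g: "g \<in> G" and x: "x \<in> P" for g x
  proof -
    have gx: "g x \<in> P" using bij[OF g] x by (auto simp: bij_betw_def)
    have "g x \<in> orbit (aut_group P Bs\<lparr>carrier := G\<rparr>) (\<lambda>g. g) x"
      using g by (auto simp: orbit_def)
    then show ?thesis
      using A.orbit_sym[OF x gx] A.orbit_trans[OF a x gx] A.orbit_trans[OF a gx x] by blast
  qed
  have card_eq: "card (C \<inter> ?O) = card (E \<inter> ?O)" if CE: "C \<in> Bs" "E \<in> Bs" for C E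
  proof -
    obtain g where g: "g \<in> G" "g ` C = E" using tr CE by blast
    have "g ` (C \<inter> ?O) = E \<inter> ?O" using inv[OF g(1)] Bs CE g(2) by blast
    moreover have "inj_on g (C \<inter> ?O)"
      using bij[OF g(1)] Bs CE by (meson bij_betw_def inf.coboundedI1 inj_on_subset)
    ultimately show ?thesis by (metis card_image)
  qed
  obtain m where "\<And>C. C \<in> Bs \<Longrightarrow> card (C \<inter> ?O) = m" using card_eq by metis
  then show ?thesis
    using constant_block_intersection_imp_whole[OF N sub] ne by blast
qed

section \<open>Stabilizer orders\<close>

text \<open>
  Finiteness makes the stabilizer orders positive; \<^const>\<open>card\<close> would be \<open>0\<close> on infinite ones.
\<close>

lemma finite_aut_group:
  assumes "finite P"
  shows "finite (carrier (aut_group P Bs))"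
proof -
  have "carrier (aut_group P Bs) \<subseteq> P \<rightarrow>\<^sub>E P"
    by (auto simp: aut_group_carrier Bij_def PiE_def Pi_def bij_betw_apply)
  then show ?thesis using assms by (meson finite_PiE finite_subset)
qed

theorem lemma2p6:
  fixes P :: "'a set" and Bs :: "'a set set" and v k :: nat
    and G :: "('a \<Rightarrow> 'a) set" and \<alpha> :: 'a and B :: "'a set"
  assumes "nontrivial_three_design P Bs v k"
    and "block_transitive P Bs G"
    and "\<alpha> \<in> P" and "B \<in> Bs"
  shows "card (point_stabilizer P Bs G \<alpha>) * (k * (k - 1) * (k - 2))
           = card (block_stabilizer P Bs G B) * ((v - 1) * (v - 2))
    \<and> real (card (point_stabilizer P Bs G \<alpha>)) *
        (real (card (point_stabilizer P Bs G \<alpha>)) / real (card (block_stabilizer P Bs G B)) + 2)\<^sup>2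
          > real (card G)
    \<and> real (gcd (card (point_stabilizer P Bs G \<alpha>)) ((v - 1) * (v - 2))) > sqrt (real v) - 2"
proof -
  have D: "three_design P Bs v k" and k: "3 < k" "k < v"
    using assms(1) by (auto simp: nontrivial_three_design_def)
  note D' = three_designD[OF D]
  have Bs: "\<forall>C\<in>Bs. C \<subseteq> P" using D'(3) by blast
  have G: "subgroup G (aut_group P Bs)" and tr: "\<forall>C\<in>Bs. \<forall>E\<in>Bs. \<exists>g\<in>G. g ` C = E"
    using assms(2) block_transitive_iff[OF Bs] by auto
  let ?H = "aut_group P Bs\<lparr>carrier := G\<rparr>"
  define a where "a = card (point_stabilizer P Bs G \<alpha>)"
  define s where "s = card (block_stabilizer P Bs G B)"
  define K where "K = k * (k - 1) * (k - 2)"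
  define M where "M = (v - 1) * (v - 2)"
  have finG: "finite G"
    using finite_subset[OF subgroup.subset[OF G] finite_aut_group[OF D'(1)]] .
  have "card G > 0" using finG subgroup.one_closed[OF G] by (auto simp: card_gt_0_iff)
  have Ga: "v * a = card G"
    using group_action.orbit_stabilizer_theorem[OF group_action_points[OF Bs G] assms(3)]
      block_transitive_imp_point_transitive[OF assms(1-3)] D'(2)
    by (simp add: a_def point_stabilizer_def order_def)
  have "g ` B \<in> Bs" if "g \<in> G" for g
    using that assms(4) subgroup.subset[OF G] bij_betw_apply[of "(`) g" Bs Bs B]
    by (auto simp: subset_iff aut_group_carrier)
  then have "orbit ?H (block_action Bs) B = Bs"
    using tr assms(4) by (auto simp: orbit_def block_action_def) metis
  then have Gs: "card Bs * s = card G"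
    using group_action.orbit_stabilizer_theorem[OF group_action_blocks[OF Bs G] assms(4)]
    by (simp add: s_def block_stabilizer_def order_def)
  have pos: "0 < a" "0 < s" using Ga Gs \<open>card G > 0\<close> by (auto intro: Nat.gr0I)
  have "v * (a * K) = card Bs * K * s" using Ga Gs by (simp add: ac_simps)
  also have "\<dots> = v * (s * M)"
    using card_blocks[OF D] by (simp add: K_def M_def ac_simps)
  finally have one: "a * K = s * M" using k by simp
  have Kpos: "0 < K" using k by (simp add: K_def)
  have lt: "(sqrt v - 2) * real K < real M"
    using sqrt_less_quotient[OF k nontrivial_three_design_bound[OF assms(1,4)]] k
    by (simp add: K_def M_def of_nat_diff)
  have "real a * real K = real s * real M" using one by (metis of_nat_mult)
  then have quot: "real a / real s = real M / real K"
    using pos Kpos by (simp add: field_simps)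
  have "sqrt v < real a / real s + 2"
    using lt Kpos unfolding quot by (simp add: field_simps)
  then have "(sqrt v)\<^sup>2 < (real a / real s + 2)\<^sup>2" by (intro power_strict_mono) auto
  then have "real a * real v < real a * (real a / real s + 2)\<^sup>2" using pos by simp
  then have two: "real (card G) < real a * (real a / real s + 2)\<^sup>2"
    by (simp add: mult.commute[of v] flip: Ga)
  have "M dvd gcd a M * K"
  proof -
    have "M dvd gcd (a * K) (M * K)" using one by simp
    then show ?thesis by (simp add: gcd_mult_distrib_nat mult.commute)
  qed
  moreover have "0 < gcd a M * K" using pos Kpos by simp
  ultimately have "M \<le> gcd a M * K" by (rule dvd_imp_le)
  then have "real M \<le> real (gcd a M) * real K" by (metis of_nat_le_iff of_nat_mult)
  then have "(sqrt v - 2) * real K < real (gcd a M) * real K" using lt by simp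
  then have three: "sqrt v - 2 < real (gcd a M)" using Kpos by simp
  show ?thesis using one two three by (simp add: a_def s_def K_def M_def)
qed

end
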